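(* Let $(\Omega_Y,d_Y)$ be a negative-type metric space with isometric embedding $\phi:\Omega_Y\to\mathcal H$ into a real Hilbert space $\mathcal H$, let $Y$ be a random element of $\Omega_Y$, let $X=(X_1,\dots,X_p)$ be random covariates with $X_j$ taking values in $\Omega_{X_j}$, and fix $y_0\in\Omega_Y$. Suppose that $$\phi(Y)=\sum_{j=1}^p f_j(X_j)+\epsilon ,$$ where each $f_j:\Omega_{X_j}\to\mathcal H$ is a (measurable) mapping and $\epsilon$ is an $\mathcal H$-valued random element independent of $X$. Then the conditional expected discrepancy admits an additive decomposition: there are real numbers $c_0(y)$ (not depending on $x$) and functions $c_{yj}:\Omega_{X_j}\to\mathbb R$, $j=1,\dots,p$, such that for every $y\in\Omega_Y$ $$\mathbb E\big[d_Y^2(Y,y)-d_Y^2(Y,y_0)\,\big|\,X=x\big]=c_0(y)+\sum_{j=1}^p c_{yj}(x_j)$$ for $P_X$-almost every $x=(x_1,\dots,x_p)$. Moreover, these can be chosen such that: (1) $c_{yj}(\cdot)$ is the zero function whenever $\langle \phi(y)-\phi(y_0),f_j(x_j)\rangle_{\mathcal H}=0$ for all $x_j\in\Omega_{X_j}$; (2) the sparsity pattern $\{j\in\{1,\dots,p\}: c_{yj}\not\equiv 0\}$ is the same for all $y\in\Omega_Y$, except for those $y$ for which $\phi(y)$ lies in a certain union of at most $p$ proper affine subspaces of $\mathcal H$, each of the form $\phi(y_0)+V$ with $V\subsetneq\mathcal H$ a linear subspace.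
   Context: $(\Omega_Y,d_Y)$ is a metric space and $\Omega_{X_1},\dots,\Omega_{X_p}$ are separable metric spaces, all with Borel $\sigma$-fields; $(X,Y)$ is defined on a common probability space, and $P_X$ is the law of $X$. In the paper's usage, when $(\Omega_Y,d_Y)$ is of negative type the metric $d_Y$ admits an isometric embedding into a Hilbert space: there are a Hilbert space $\mathcal H$ and a map $\phi:\Omega_Y\to\mathcal H$ with $d_Y(y,y')=\|\phi(y)-\phi(y')\|_{\mathcal H}$ for all $y,y'\in\Omega_Y$. The conditional expectations $\mathbb E[d_Y^2(Y,y)-d_Y^2(Y,y_0)\mid X=x]$ are assumed to exist for every $y$. *)

theory Defs
  imports "HOL-Probability.Probability"
begin

definition borel_of :: "'a topology \<Rightarrow> 'a measure" where
  "borel_of T = sigma (topspace T) {U. openin T U}"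

definition joint_space :: "nat \<Rightarrow> (nat \<Rightarrow> 'a metric) \<Rightarrow> (nat \<Rightarrow> 'a) measure" where
  "joint_space p \<Omega> = (\<Pi>\<^sub>M j\<in>{1..p}. borel_of (mtopology_of (\<Omega> j)))"

definition joint :: "nat \<Rightarrow> (nat \<Rightarrow> 'w \<Rightarrow> 'a) \<Rightarrow> 'w \<Rightarrow> nat \<Rightarrow> 'a" where
  "joint p X \<omega> = (\<lambda>j\<in>{1..p}. X j \<omega>)"

text \<open>
  The sigma-algebras generated by \<open>U\<close> and \<open>V\<close> are independent; the library's \<open>indep_var\<close> is
  not used because it forces \<open>U\<close> and \<open>V\<close> to take values in the same type.
\<close>

definition indep_of :: "'w measure \<Rightarrow> 'b measure \<Rightarrow> ('w \<Rightarrow> 'b) \<Rightarrow> 'c measure \<Rightarrow> ('w \<Rightarrow> 'c) \<Rightarrow> bool" where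
  "indep_of M S U T V \<longleftrightarrow>
     prob_space.indep_set M (sets (vimage_algebra (space M) U S)) (sets (vimage_algebra (space M) V T))"

text \<open>
  \<open>cond_exp_version M N X Z h\<close> says that the conditional expectation of \<open>Z\<close> given \<open>X\<close> exists and
  that \<open>h\<close> is a version of the function \<open>x \<mapsto> E[Z | X = x]\<close>: it is measurable on the
  space of values of \<open>X\<close>, and \<open>h(X) = E[Z | X]\<close> almost surely. Existence is taken
  in the wide sense \<open>E[\<bar>Z\<bar> | X] < \<infinity>\<close> almost surely, in which case \<open>real_cond_exp\<close> is
  \<open>E[Z\<^sup>+ | X] - E[Z\<^sup>- | X]\<close>; every integrable \<open>Z\<close> is covered.
\<close>

definition cond_exp_version ::
    "'w measure \<Rightarrow> 'b measure \<Rightarrow> ('w \<Rightarrow> 'b) \<Rightarrow> ('w \<Rightarrow> real) \<Rightarrow> ('b \<Rightarrow> real) \<Rightarrow> bool" where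
  "cond_exp_version M N X Z h \<longleftrightarrow>
     Z \<in> borel_measurable M \<and>
     (AE \<omega> in M. nn_cond_exp M (vimage_algebra (space M) X N) (\<lambda>\<omega>. ennreal \<bar>Z \<omega>\<bar>) \<omega> < \<infinity>) \<and>
     h \<in> borel_measurable N \<and>
     (AE \<omega> in M. h (X \<omega>) = real_cond_exp M (vimage_algebra (space M) X N) Z \<omega>)"

definition discrepancy :: "('w \<Rightarrow> 'y::metric_space) \<Rightarrow> 'y \<Rightarrow> 'y \<Rightarrow> 'w \<Rightarrow> real" where
  "discrepancy Y y0 y \<omega> = (dist (Y \<omega>) y)\<^sup>2 - (dist (Y \<omega>) y0)\<^sup>2"

definition sparsity_pattern :: "nat \<Rightarrow> (nat \<Rightarrow> 'a metric) \<Rightarrow> (nat \<Rightarrow> 'a \<Rightarrow> real) \<Rightarrow> nat set" where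
  "sparsity_pattern p \<Omega> g = {j\<in>{1..p}. \<exists>x\<in>mspace (\<Omega> j). g j x \<noteq> 0}"

end

theory Submission
  imports Defs
begin

text \<open>
  The quadratic terms \<open>(norm (\<phi> (Y \<omega>)))\<^sup>2\<close> cancel in the discrepancy (\<open>norm_diff_sq_diff\<close>), so it
  is an affine function of \<open>\<phi> (Y \<omega>)\<close> with linear part \<open>- 2 * inner v (\<phi> (Y \<omega>))\<close>, where
  \<open>v = \<phi> y - \<phi> y0\<close>. Inserting the model splits it into \<open>\<Sum>j=1..p. - 2 * inner v (f j (X j \<omega>))\<close>,
  which is a function of \<open>X\<close>, and a real variable \<open>U\<close> that depends on \<open>\<epsilon>\<close> only and is therefore
  independent of \<open>X\<close>. Conditioning on \<open>X\<close> keeps the first part and replaces \<open>U\<close> by its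
  expectation, so \<open>c0 y\<close> is the expectation of \<open>U\<close> and
  \<open>c y j x = - 2 * inner v (f j x)\<close>.

  No moment of \<open>\<epsilon>\<close> or of the \<open>f j (X j)\<close> is assumed; all that is known is that the discrepancy has
  an almost surely finite absolute moment conditionally on \<open>X\<close>. Lemma \<open>integrable_indep_summand\<close>
  derives from this that \<open>U\<close> is integrable. The part that depends on \<open>X\<close> may well fail to be
  integrable, so \<open>real_cond_exp_add_indep\<close> computes the conditional expectation on the events where
  that part is bounded, and these exhaust the space.

  For the sparsity pattern, let \<open>V j\<close> be the space of vectors orthogonal to all values of \<open>f j\<close>.
  Then \<open>c y j\<close> vanishes identically exactly if \<open>v\<close> lies in \<open>V j\<close>. If \<open>V j\<close> is the whole space,
  then \<open>j\<close> is never in the pattern; otherwise \<open>V j\<close> is a proper subspace and \<open>j\<close> is in the pattern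
  unless \<open>\<phi> y\<close> lies in \<open>\<phi> y0 + V j\<close>. Away from these at most \<open>p\<close> affine subspaces the pattern is
  the set of all \<open>j\<close> for which \<open>V j\<close> is proper.
\<close>

section \<open>Expectations of independent factors\<close>

text \<open>
  The bridge from independent sigma-algebras, the form in which independence is assumed, to
  independent random variables, for which product formulas are at hand. It will be used with an
  indicator as one of the two variables.
\<close>

lemma (in prob_space) indep_var_of_indep_set:
  assumes ind: "indep_set (sets G) (sets F)"
    and "space G = space M" "space F = space M"
    and U: "U \<in> measurable G S" and V: "V \<in> measurable F T"
  shows "indep_var S U T V"
proof -
  have G: "sets G \<subseteq> events" and F: "sets F \<subseteq> events"
    using indep_setD_ev1[OF ind] indep_setD_ev2[OF ind] by auto
  have UG: "sigma_sets (space M) {U -` A \<inter> space M |A. A \<in> sets S} \<subseteq> sets G"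
    unfolding assms(2)[symmetric] using measurable_sets[OF U] by (intro sets.sigma_sets_subset) auto
  have VF: "sigma_sets (space M) {V -` A \<inter> space M |A. A \<in> sets T} \<subseteq> sets F"
    unfolding assms(3)[symmetric] using measurable_sets[OF V] by (intro sets.sigma_sets_subset) auto
  have "U \<in> measurable M S" "V \<in> measurable M T"
    using U V G F assms(2,3) by (auto simp: measurable_def)
  then show ?thesis
    unfolding indep_var_eq using ind UG VF unfolding indep_sets2_eq by (meson subset_iff)
qed

text \<open>
  Values in \<open>ennreal\<close> are essential: the formula serves to prove integrability of a factor, and so
  cannot presuppose it.
\<close>

lemma (in prob_space) indep_var_nn_integral_mult:
  fixes U V :: "'a \<Rightarrow> ennreal"
  assumes "indep_var borel U borel V"
  shows "(\<integral>\<^sup>+\<omega>. U \<omega> * V \<omega> \<partial>M) = (\<integral>\<^sup>+\<omega>. U \<omega> \<partial>M) * (\<integral>\<^sup>+\<omega>. V \<omega> \<partial>M)"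
proof -
  have "case_bool borel borel = (\<lambda>_::bool. borel :: ennreal measure)"
    by (auto split: bool.split)
  then have "indep_vars (\<lambda>_. borel) (case_bool U V) UNIV"
    using assms by (simp add: indep_var_def)
  from indep_vars_nn_integral[OF _ this] show ?thesis
    by (simp add: UNIV_bool ac_simps)
qed

section \<open>Conditioning a sum with one independent summand\<close>

text \<open>
  On some event \<open>B\<close> of \<open>F\<close> with positive probability both \<open>G\<close> and the conditional absolute moment of
  \<open>Z\<close> are bounded. There \<open>U = Z - G\<close> has a finite absolute moment, and by independence this moment is
  the product of the probability of \<open>B\<close> and the full absolute moment of \<open>U\<close>.
\<close>

lemma (in prob_space) integrable_indep_summand:
  fixes G U Z :: "'a \<Rightarrow> real"
  assumes sub: "subalgebra M F" "subalgebra M H"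
    and ind: "indep_set (sets H) (sets F)"
    and G: "G \<in> borel_measurable F" and U: "U \<in> borel_measurable H"
    and Z: "Z \<in> borel_measurable M" and sum: "AE \<omega> in M. Z \<omega> = G \<omega> + U \<omega>"
    and fin: "AE \<omega> in M. nn_cond_exp M F (\<lambda>\<omega>. ennreal \<bar>Z \<omega>\<bar>) \<omega> < \<infinity>"
  shows "integrable M U"
proof -
  interpret finite_measure_subalgebra M F
    using sub(1) by unfold_locales
  note [measurable] = G Z measurable_from_subalg[OF sub(1) G] measurable_from_subalg[OF sub(2) U]
  define E where "E = nn_cond_exp M F (\<lambda>\<omega>. ennreal \<bar>Z \<omega>\<bar>)"
  have E[measurable]: "E \<in> borel_measurable F" by (simp add: E_def)
  define B where "B n = {\<omega> \<in> space F. \<bar>G \<omega>\<bar> \<le> real n \<and> E \<omega> \<le> of_nat n}" for n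
  have BF[measurable]: "B n \<in> sets F" for n unfolding B_def by measurable
  have BM[measurable]: "B n \<in> sets M" for n
    using BF sub(1) by (auto simp: subalgebra_def)
  \<comment> \<open>\<open>G\<close> and, almost surely, \<open>E\<close> take finite values, so the sets \<open>B n\<close> cover almost all of the space.\<close>
  have "\<exists>n. prob (B n) \<noteq> 0"
  proof (rule ccontr)
    assume "\<nexists>n. prob (B n) \<noteq> 0"
    then have "AE \<omega> in M. \<forall>n. \<omega> \<notin> B n"
      by (auto simp: AE_all_countable prob_eq_0)
    with fin AE_space have "AE \<omega> in M. False"
    proof eventually_elim
      case (elim \<omega>)
      obtain m where m: "E \<omega> \<le> of_nat m"
        using elim(1) ennreal_Ex_less_of_nat[of "E \<omega>"] unfolding E_def by (auto intro: less_imp_le)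
      obtain k where k: "\<bar>G \<omega>\<bar> \<le> real k" using real_arch_simple by blast
      have "\<omega> \<in> B (max m k)"
        using m k elim(2) sub(1) unfolding B_def subalgebra_def
        by (auto intro: order_trans simp flip: of_nat_max)
      then show ?case using elim by auto
    qed
    then show False by simp
  qed
  then obtain n where n: "prob (B n) \<noteq> 0" by blast
  have "(\<integral>\<^sup>+\<omega>. indicator (B n) \<omega> * ennreal \<bar>Z \<omega>\<bar> \<partial>M) = (\<integral>\<^sup>+\<omega>. indicator (B n) \<omega> * E \<omega> \<partial>M)"
    unfolding E_def by (rule nn_cond_exp_intg[symmetric]) auto
  also have "\<dots> \<le> (\<integral>\<^sup>+\<omega>. of_nat n \<partial>M)"
    by (intro nn_integral_mono) (auto simp: B_def split: split_indicator)
  also have "\<dots> < \<infinity>"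
    by (simp add: emeasure_space_1 of_nat_less_top)
  finally have Z_fin: "(\<integral>\<^sup>+\<omega>. indicator (B n) \<omega> * ennreal \<bar>Z \<omega>\<bar> \<partial>M) < \<infinity>" .
  have "(\<integral>\<^sup>+\<omega>. ennreal \<bar>U \<omega>\<bar> * indicator (B n) \<omega> \<partial>M)
      \<le> (\<integral>\<^sup>+\<omega>. indicator (B n) \<omega> * ennreal \<bar>Z \<omega>\<bar> + ennreal (real n) \<partial>M)"
    using sum
    by (intro nn_integral_mono_AE, eventually_elim)
      (auto simp: B_def simp flip: ennreal_plus split: split_indicator intro!: ennreal_leI)
  also have "\<dots> = (\<integral>\<^sup>+\<omega>. indicator (B n) \<omega> * ennreal \<bar>Z \<omega>\<bar> \<partial>M) + ennreal (real n)"
    by (subst nn_integral_add) (auto simp: emeasure_space_1)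
  finally have "(\<integral>\<^sup>+\<omega>. ennreal \<bar>U \<omega>\<bar> * indicator (B n) \<omega> \<partial>M) < \<infinity>"
    using Z_fin by (auto simp: top_unique less_top[symmetric])
  moreover have "(\<integral>\<^sup>+\<omega>. ennreal \<bar>U \<omega>\<bar> * indicator (B n) \<omega> \<partial>M)
      = (\<integral>\<^sup>+\<omega>. ennreal \<bar>U \<omega>\<bar> \<partial>M) * ennreal (prob (B n))"
  proof -
    have "indep_var borel (\<lambda>\<omega>. ennreal \<bar>U \<omega>\<bar>) borel (indicator (B n) :: 'a \<Rightarrow> ennreal)"
      using U sub by (intro indep_var_of_indep_set[OF ind]) (auto simp: subalgebra_def)
    from indep_var_nn_integral_mult[OF this] show ?thesis
      by (simp add: emeasure_eq_measure)
  qed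
  ultimately have "(\<integral>\<^sup>+\<omega>. ennreal \<bar>U \<omega>\<bar> \<partial>M) < \<infinity>"
    using n by (auto simp: ennreal_mult_eq_top_iff less_top[symmetric] measure_nonneg)
  then show ?thesis by (simp add: integrable_iff_bounded)
qed

lemma (in prob_space) real_cond_exp_indep:
  fixes U :: "'a \<Rightarrow> real"
  assumes sub: "subalgebra M F" "subalgebra M H"
    and ind: "indep_set (sets H) (sets F)"
    and U: "U \<in> borel_measurable H" and int: "integrable M U"
  shows "AE \<omega> in M. real_cond_exp M F U \<omega> = expectation U"
proof -
  interpret finite_measure_subalgebra M F
    using sub(1) by unfold_locales
  show ?thesis
  proof (rule real_cond_exp_charact)
    fix A assume A: "A \<in> sets F"
    then have AM: "A \<in> events" using sub(1) by (auto simp: subalgebra_def)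
    have "indep_var borel U borel (indicator A :: 'a \<Rightarrow> real)"
      using A U sub by (intro indep_var_of_indep_set[OF ind]) (auto simp: subalgebra_def)
    moreover have "integrable M (indicator A :: 'a \<Rightarrow> real)"
      using AM by (intro integrable_real_indicator) (auto simp: less_top[symmetric])
    ultimately have "expectation (\<lambda>\<omega>. U \<omega> * indicator A \<omega>) = expectation U * prob A"
      using indep_var_lebesgue_integral[OF _ int] AM by fastforce
    then show "(LINT \<omega>:A|M. U \<omega>) = (LINT \<omega>:A|M. expectation U)"
      using AM by (simp add: set_lebesgue_integral_def mult.commute)
  qed (use int in auto)
qed

text \<open>
  \<open>Z\<close> need not be integrable, so additivity of the conditional expectation does not apply to it
  directly. It does after multiplication by the indicator of an event of \<open>F\<close> on which \<open>G\<close> is bounded,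
  and such an indicator can be pulled out of the conditional expectation.
\<close>

lemma (in prob_space) real_cond_exp_add_indep:
  fixes G U Z :: "'a \<Rightarrow> real"
  assumes sub: "subalgebra M F" "subalgebra M H"
    and ind: "indep_set (sets H) (sets F)"
    and G: "G \<in> borel_measurable F" and U: "U \<in> borel_measurable H"
    and Z: "Z \<in> borel_measurable M" and sum: "AE \<omega> in M. Z \<omega> = G \<omega> + U \<omega>"
    and fin: "AE \<omega> in M. nn_cond_exp M F (\<lambda>\<omega>. ennreal \<bar>Z \<omega>\<bar>) \<omega> < \<infinity>"
  shows "AE \<omega> in M. real_cond_exp M F Z \<omega> = G \<omega> + expectation U"
proof -
  interpret finite_measure_subalgebra M F
    using sub(1) by unfold_locales
  note [measurable] = G Z measurable_from_subalg[OF sub(1) G] measurable_from_subalg[OF sub(2) U]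
  have int: "integrable M U"
    by (rule integrable_indep_summand[OF assms])
  define B where "B n = {\<omega> \<in> space F. \<bar>G \<omega>\<bar> \<le> real n}" for n
  have BF[measurable]: "B n \<in> sets F" for n unfolding B_def by measurable
  have BM[measurable]: "B n \<in> sets M" for n
    using BF sub(1) by (auto simp: subalgebra_def)
  have local: "AE \<omega> in M. indicator (B n) \<omega> * real_cond_exp M F Z \<omega> = indicator (B n) \<omega> * (G \<omega> + expectation U)" for n
  proof -
    let ?I = "indicator (B n) :: 'a \<Rightarrow> real"
    have intG: "integrable M (\<lambda>\<omega>. ?I \<omega> * G \<omega>)"
    proof (rule integrable_const_bound)
      show "AE \<omega> in M. norm (?I \<omega> * G \<omega>) \<le> real n"
        by (auto simp: B_def split: split_indicator)
    qed measurable
    have intU: "integrable M (\<lambda>\<omega>. ?I \<omega> * U \<omega>)"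
      using integrable_mult_indicator[OF BM int] by simp
    have eq: "AE \<omega> in M. ?I \<omega> * Z \<omega> = ?I \<omega> * G \<omega> + ?I \<omega> * U \<omega>"
      using sum by eventually_elim (simp add: algebra_simps)
    have intZ: "integrable M (\<lambda>\<omega>. ?I \<omega> * Z \<omega>)"
      using Bochner_Integration.integrable_add[OF intG intU] eq
      by (subst integrable_cong_AE) auto
    have "AE \<omega> in M. real_cond_exp M F (\<lambda>\<omega>. ?I \<omega> * Z \<omega>) \<omega> = ?I \<omega> * real_cond_exp M F Z \<omega>"
      by (rule real_cond_exp_mult) (use intZ in auto)
    moreover have "AE \<omega> in M. real_cond_exp M F (\<lambda>\<omega>. ?I \<omega> * U \<omega>) \<omega> = ?I \<omega> * real_cond_exp M F U \<omega>"
      by (rule real_cond_exp_mult) (use intU in auto)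
    moreover have "AE \<omega> in M. real_cond_exp M F (\<lambda>\<omega>. ?I \<omega> * G \<omega>) \<omega> = ?I \<omega> * G \<omega>"
      by (rule real_cond_exp_F_meas[OF intG]) measurable
    moreover have "AE \<omega> in M. real_cond_exp M F (\<lambda>\<omega>. ?I \<omega> * Z \<omega>) \<omega>
        = real_cond_exp M F (\<lambda>\<omega>. ?I \<omega> * G \<omega> + ?I \<omega> * U \<omega>) \<omega>"
      by (rule real_cond_exp_cong[OF eq]) measurable
    moreover note real_cond_exp_add[OF intG intU] real_cond_exp_indep[OF sub ind U int]
    ultimately show ?thesis
      by eventually_elim (simp add: algebra_simps)
  qed
  then have "AE \<omega> in M. \<forall>n. indicator (B n) \<omega> * real_cond_exp M F Z \<omega> = indicator (B n) \<omega> * (G \<omega> + expectation U)"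
    unfolding AE_all_countable by blast
  with AE_space show ?thesis
  proof eventually_elim
    case (elim \<omega>)
    obtain n where "\<bar>G \<omega>\<bar> \<le> real n" using real_arch_simple by blast
    then have "\<omega> \<in> B n" using elim(1) sub(1) by (simp add: B_def subalgebra_def)
    then show ?case using elim(2)[rule_format, of n] by simp
  qed
qed

section \<open>Squared distances and annihilators\<close>

lemma norm_diff_sq_diff:
  fixes a b c :: "'h::real_inner"
  shows "(norm (a - b))\<^sup>2 - (norm (a - c))\<^sup>2 = (norm b)\<^sup>2 - (norm c)\<^sup>2 - 2 * inner (b - c) a"
  by (simp add: power2_norm_eq_inner inner_diff_left inner_diff_right inner_commute)

text \<open>
  In a non-separable space, pairing two Borel measurable maps can fail to be Borel measurable, so
  measurability of inner products is deduced from continuity in one argument.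
\<close>

lemma borel_measurable_inner_const:
  fixes g :: "'a \<Rightarrow> 'h::real_inner"
  assumes "g \<in> borel_measurable N"
  shows "(\<lambda>x. inner v (g x)) \<in> borel_measurable N"
  by (rule measurable_compose[OF assms]) (intro borel_measurable_continuous_onI continuous_intros)

lemma subspace_annihilator:
  fixes A :: "'h::real_inner set"
  shows "subspace {v. \<forall>a\<in>A. inner v a = 0}"
  by (auto simp: subspace_def inner_add_left)

section \<open>The additive decomposition\<close>

theorem theorem1:
  fixes M :: "'w measure"
    and Y :: "'w \<Rightarrow> 'y::metric_space"
    and y0 :: 'y
    and \<phi> :: "'y \<Rightarrow> 'h::{real_inner, complete_space}"
    and p :: nat
    and \<Omega> :: "nat \<Rightarrow> 'a metric"
    and X :: "nat \<Rightarrow> 'w \<Rightarrow> 'a"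
    and f :: "nat \<Rightarrow> 'a \<Rightarrow> 'h"
    and \<epsilon> :: "'w \<Rightarrow> 'h"
  assumes "prob_space M"
    and embedding: "\<And>y y'. dist y y' = norm (\<phi> y - \<phi> y')"
    and "Y \<in> borel_measurable M"
    and separable: "\<And>j. j \<in> {1..p} \<Longrightarrow> separable_space (mtopology_of (\<Omega> j))"
    and "\<And>j. j \<in> {1..p} \<Longrightarrow> X j \<in> measurable M (borel_of (mtopology_of (\<Omega> j)))"
    and "\<And>j. j \<in> {1..p} \<Longrightarrow> f j \<in> borel_measurable (borel_of (mtopology_of (\<Omega> j)))"
    and "\<epsilon> \<in> borel_measurable M"
    and indep: "indep_of M borel \<epsilon> (joint_space p \<Omega>) (joint p X)"
    and model: "AE \<omega> in M. \<phi> (Y \<omega>) = (\<Sum>j=1..p. f j (X j \<omega>)) + \<epsilon> \<omega>"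
    and cond_exp_exists:
      "\<And>y. \<exists>h. cond_exp_version M (joint_space p \<Omega>) (joint p X) (discrepancy Y y0 y) h"
  shows "\<exists>(c0 :: 'y \<Rightarrow> real) (c :: 'y \<Rightarrow> nat \<Rightarrow> 'a \<Rightarrow> real).
     (\<forall>y h. cond_exp_version M (joint_space p \<Omega>) (joint p X) (discrepancy Y y0 y) h \<longrightarrow>
        (AE x in distr M (joint_space p \<Omega>) (joint p X). h x = c0 y + (\<Sum>j=1..p. c y j (x j)))) \<and>
     (\<forall>y. \<forall>j\<in>{1..p}. (\<forall>x\<in>mspace (\<Omega> j). inner (\<phi> y - \<phi> y0) (f j x) = 0) \<longrightarrow>
        (\<forall>x\<in>mspace (\<Omega> j). c y j x = 0)) \<and>
     (\<exists>\<V> :: 'h set set. finite \<V> \<and> card \<V> \<le> p \<and>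
        (\<forall>V\<in>\<V>. subspace V \<and> V \<noteq> UNIV) \<and>
        (\<exists>S. \<forall>y. \<phi> y \<notin> (\<Union>V\<in>\<V>. (+) (\<phi> y0) ` V) \<longrightarrow> sparsity_pattern p \<Omega> (c y) = S))"
proof -
  interpret prob_space M by fact
  let ?N = "joint_space p \<Omega>" and ?X = "joint p X"
  let ?F = "vimage_algebra (space M) ?X ?N" and ?H = "vimage_algebra (space M) \<epsilon> borel"
  have X[measurable]: "?X \<in> measurable M ?N"
    unfolding joint_space_def joint_def using assms(5) by (intro measurable_restrict) auto
  have subF: "subalgebra M ?F"
    using sets_image_in_sets[OF refl X] by (simp add: subalgebra_def)
  have subH: "subalgebra M ?H"
    using sets_image_in_sets[OF refl assms(7)] by (simp add: subalgebra_def)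
  have ind: "indep_set (sets ?H) (sets ?F)"
    using indep by (simp add: indep_of_def)
  have \<epsilon>_H: "\<epsilon> \<in> borel_measurable ?H"
    by (rule measurable_vimage_algebra1) simp
  have X_F: "?X \<in> measurable ?F ?N"
    using measurable_space[OF X] by (intro measurable_vimage_algebra1) auto

  \<comment> \<open>The constant \<open>(norm (\<phi> y))\<^sup>2 - (norm (\<phi> y0))\<^sup>2\<close> is put into \<open>U\<close>, so that \<open>c y j\<close> stays
    homogeneous in \<open>\<phi> y - \<phi> y0\<close> and vanishes whenever the inner products do.\<close>
  define c :: "'y \<Rightarrow> nat \<Rightarrow> 'a \<Rightarrow> real"
    where "c y j x = - 2 * inner (\<phi> y - \<phi> y0) (f j x)" for y j x
  define U :: "'y \<Rightarrow> 'w \<Rightarrow> real"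
    where "U y \<omega> = (norm (\<phi> y))\<^sup>2 - (norm (\<phi> y0))\<^sup>2 - 2 * inner (\<phi> y - \<phi> y0) (\<epsilon> \<omega>)" for y \<omega>
  define V where "V j = {v. \<forall>a\<in>f j ` mspace (\<Omega> j). inner v a = 0}" for j
  have c_meas: "(\<lambda>x. \<Sum>j=1..p. c y j (x j)) \<in> borel_measurable ?N" for y
  proof (rule borel_measurable_sum)
    fix j assume j: "j \<in> {1..p}"
    have "(\<lambda>x. x j) \<in> measurable ?N (borel_of (mtopology_of (\<Omega> j)))"
      unfolding joint_space_def using j by (rule measurable_component_singleton)
    from measurable_compose[OF this assms(6)[OF j]]
    have "(\<lambda>x. f j (x j)) \<in> borel_measurable ?N" .
    then show "(\<lambda>x. c y j (x j)) \<in> borel_measurable ?N"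
      unfolding c_def by (intro borel_measurable_times borel_measurable_const borel_measurable_inner_const)
  qed
  have U_H: "U y \<in> borel_measurable ?H" for y
    unfolding U_def using \<epsilon>_H
    by (intro borel_measurable_diff borel_measurable_times borel_measurable_const borel_measurable_inner_const)

  have decomp: "AE x in distr M ?N ?X. h x = expectation (U y) + (\<Sum>j=1..p. c y j (x j))"
    if h: "cond_exp_version M ?N ?X (discrepancy Y y0 y) h" for y h
  proof -
    have sum: "AE \<omega> in M. discrepancy Y y0 y \<omega> = (\<Sum>j=1..p. c y j (?X \<omega> j)) + U y \<omega>"
      using model
    proof eventually_elim
      case (elim \<omega>)
      have "(\<Sum>j=1..p. c y j (?X \<omega> j)) = - 2 * inner (\<phi> y - \<phi> y0) (\<Sum>j=1..p. f j (X j \<omega>))"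
        by (simp add: c_def joint_def inner_sum_right sum_distrib_left)
      then show ?case
        by (simp add: discrepancy_def embedding norm_diff_sq_diff elim U_def inner_add_right)
    qed
    have "AE \<omega> in M. real_cond_exp M ?F (discrepancy Y y0 y) \<omega>
        = (\<Sum>j=1..p. c y j (?X \<omega> j)) + expectation (U y)"
      using h measurable_compose[OF X_F c_meas]
      by (intro real_cond_exp_add_indep[OF subF subH ind _ U_H _ sum])
        (auto simp: cond_exp_version_def)
    moreover have "AE \<omega> in M. h (?X \<omega>) = real_cond_exp M ?F (discrepancy Y y0 y) \<omega>"
      using h by (simp add: cond_exp_version_def)
    ultimately have "AE \<omega> in M. h (?X \<omega>) = expectation (U y) + (\<Sum>j=1..p. c y j (?X \<omega> j))"
      by eventually_elim simp
    moreover have "{x \<in> space ?N. h x = expectation (U y) + (\<Sum>j=1..p. c y j (x j))} \<in> sets ?N"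
    proof -
      have [measurable]: "h \<in> borel_measurable ?N"
        using h by (simp add: cond_exp_version_def)
      note [measurable] = c_meas[of y]
      show ?thesis by measurable
    qed
    ultimately show ?thesis
      by (subst AE_distr_iff[OF X])
  qed

  \<comment> \<open>\<open>V j\<close> is a subspace with \<open>\<phi> y - \<phi> y0 \<in> V j\<close> exactly if \<open>c y j\<close> vanishes on \<open>\<Omega> j\<close>, so the
    indices with \<open>V j = UNIV\<close> have to be left out of the exceptional family: they are never in the pattern.\<close>
  let ?S = "{j \<in> {1..p}. V j \<noteq> UNIV}"
  have pattern: "sparsity_pattern p \<Omega> (c y) = ?S"
    if y: "\<phi> y \<notin> (\<Union>W\<in>V ` ?S. (+) (\<phi> y0) ` W)" for y
  proof -
    have "(\<exists>x\<in>mspace (\<Omega> j). c y j x \<noteq> 0) \<longleftrightarrow> \<phi> y - \<phi> y0 \<notin> V j" for j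
      by (auto simp: c_def V_def)
    moreover have "\<phi> y - \<phi> y0 \<notin> V j" if "j \<in> ?S" for j
    proof
      assume "\<phi> y - \<phi> y0 \<in> V j"
      then have "\<phi> y0 + (\<phi> y - \<phi> y0) \<in> (+) (\<phi> y0) ` V j" by (rule imageI)
      with y that show False by auto
    qed
    ultimately show ?thesis
      by (auto simp: sparsity_pattern_def)
  qed
  have card: "card (V ` ?S) \<le> p"
  proof -
    have "card (V ` ?S) \<le> card ?S" by (rule card_image_le) simp
    also have "\<dots> \<le> card {1..p}" by (rule card_mono) auto
    finally show ?thesis by simp
  qed
  show ?thesis
  proof (intro exI[of _ "\<lambda>y. expectation (U y)"] exI[of _ c] conjI)
    show "\<forall>y h. cond_exp_version M ?N ?X (discrepancy Y y0 y) h \<longrightarrow>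
        (AE x in distr M ?N ?X. h x = expectation (U y) + (\<Sum>j=1..p. c y j (x j)))"
      using decomp by blast
    show "\<forall>y. \<forall>j\<in>{1..p}. (\<forall>x\<in>mspace (\<Omega> j). inner (\<phi> y - \<phi> y0) (f j x) = 0) \<longrightarrow>
        (\<forall>x\<in>mspace (\<Omega> j). c y j x = 0)"
      by (simp add: c_def)
    show "\<exists>\<V> :: 'h set set. finite \<V> \<and> card \<V> \<le> p \<and>
        (\<forall>V\<in>\<V>. subspace V \<and> V \<noteq> UNIV) \<and>
        (\<exists>S. \<forall>y. \<phi> y \<notin> (\<Union>V\<in>\<V>. (+) (\<phi> y0) ` V) \<longrightarrow> sparsity_pattern p \<Omega> (c y) = S)"
      using card pattern subspace_annihilator[of "f _ ` mspace (\<Omega> _)"]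
      by (intro exI[of _ "V ` ?S"] conjI exI[of _ ?S]) (auto simp: V_def)
  qed
qed

end
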